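(* For every sequent $\Gamma\Rightarrow C$ (with $\Gamma$ a finite multiset of formulae and $C$ a formula), $\Gamma\Rightarrow C$ is derivable in $\mathsf{G0T}^{i}$ if and only if it is derivable in $\mathsf{G3ip}$.
   Context: Formulae are generated from a countable set of propositional variables by $A ::= p \mid \bot \mid A\land A \mid A\lor A \mid A\to A$. Rules below are written premisses / conclusion. The calculus $\mathsf{G0T}^{i}$. Sequents $\Gamma\Rightarrow C$ with $\Gamma$ a finite multiset and $C$ a formula. Initial sequents: $A\Rightarrow A$ and $\bot\Rightarrow C$ for arbitrary formulae $A,C$. Structural rules: weakening $\Gamma\Rightarrow C$ / $A,\Gamma\Rightarrow C$; contraction $A,A,\Gamma\Rightarrow C$ / $A,\Gamma\Rightarrow C$. Operational rules: - $A,B,\Gamma\Rightarrow C$ / $A\land B,\Gamma\Rightarrow C$. - $A,\Gamma\Rightarrow C$ and $B,\Delta\Rightarrow C$ / $A\lor B,\Gamma,\Delta\Rightarrow C$. - $\Gamma\Rightarrow A$ and $B,\Delta\Rightarrow C$ / $A\to B,\Gamma,\Delta\Rightarrow C$. - $\Gamma\Rightarrow A$ and $\Delta\Rightarrow B$ / $\Gamma,\Delta\Rightarrow A\land B$. - $\Gamma\Rightarrow A$ / $\Gamma\Rightarrow A\lor B$; and $\Gamma\Rightarrow B$ / $\Gamma\Rightarrow A\lor B$. - $A,\Gamma\Rightarrow B$ / $\Gamma\Rightarrow A\to B$. The calculus $\mathsf{G3ip}$. Sequents $\Gamma\Rightarrow C$ with $\Gamma$ a finite multiset and $C$ a formula.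 Initial sequents: $p,\Gamma\Rightarrow p$ ($p$ a variable) and $\bot,\Gamma\Rightarrow C$. Rules: - $A,B,\Gamma\Rightarrow C$ / $A\land B,\Gamma\Rightarrow C$. - $A,\Gamma\Rightarrow C$ and $B,\Gamma\Rightarrow C$ / $A\lor B,\Gamma\Rightarrow C$. - $A\to B,\Gamma\Rightarrow A$ and $B,\Gamma\Rightarrow C$ / $A\to B,\Gamma\Rightarrow C$. - $\Gamma\Rightarrow A$ and $\Gamma\Rightarrow B$ / $\Gamma\Rightarrow A\land B$. - $\Gamma\Rightarrow A$ / $\Gamma\Rightarrow A\lor B$; and $\Gamma\Rightarrow B$ / $\Gamma\Rightarrow A\lor B$. - $A,\Gamma\Rightarrow B$ / $\Gamma\Rightarrow A\to B$. *)

theory Defs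
  imports "HOL-Library.Multiset" "HOL-Library.Countable"
begin

text \<open>The type parameter is the set of propositional variables;
  its countability is imposed where the type is used.\<close>

datatype 'v form =
    Var 'v
  | Bot
  | Conj "'v form" "'v form"
  | Disj "'v form" "'v form"
  | Imp "'v form" "'v form"

inductive G0Ti :: "'v form multiset \<Rightarrow> 'v form \<Rightarrow> bool" where
  Ax: "G0Ti {#A#} A"
| BotL: "G0Ti {#Bot#} C"
| Weak: "G0Ti \<Gamma> C \<Longrightarrow> G0Ti (add_mset A \<Gamma>) C"
| Contr: "G0Ti (add_mset A (add_mset A \<Gamma>)) C \<Longrightarrow> G0Ti (add_mset A \<Gamma>) C"
| ConjL: "G0Ti (add_mset A (add_mset B \<Gamma>)) C \<Longrightarrow> G0Ti (add_mset (Conj A B) \<Gamma>) C"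
| DisjL: "G0Ti (add_mset A \<Gamma>) C \<Longrightarrow> G0Ti (add_mset B \<Delta>) C
    \<Longrightarrow> G0Ti (add_mset (Disj A B) (\<Gamma> + \<Delta>)) C"
| ImpL: "G0Ti \<Gamma> A \<Longrightarrow> G0Ti (add_mset B \<Delta>) C
    \<Longrightarrow> G0Ti (add_mset (Imp A B) (\<Gamma> + \<Delta>)) C"
| ConjR: "G0Ti \<Gamma> A \<Longrightarrow> G0Ti \<Delta> B \<Longrightarrow> G0Ti (\<Gamma> + \<Delta>) (Conj A B)"
| DisjR1: "G0Ti \<Gamma> A \<Longrightarrow> G0Ti \<Gamma> (Disj A B)"
| DisjR2: "G0Ti \<Gamma> B \<Longrightarrow> G0Ti \<Gamma> (Disj A B)"
| ImpR: "G0Ti (add_mset A \<Gamma>) B \<Longrightarrow> G0Ti \<Gamma> (Imp A B)"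

inductive G3ip :: "'v form multiset \<Rightarrow> 'v form \<Rightarrow> bool" where
  Ax: "G3ip (add_mset (Var p) \<Gamma>) (Var p)"
| BotL: "G3ip (add_mset Bot \<Gamma>) C"
| ConjL: "G3ip (add_mset A (add_mset B \<Gamma>)) C \<Longrightarrow> G3ip (add_mset (Conj A B) \<Gamma>) C"
| DisjL: "G3ip (add_mset A \<Gamma>) C \<Longrightarrow> G3ip (add_mset B \<Gamma>) C
    \<Longrightarrow> G3ip (add_mset (Disj A B) \<Gamma>) C"
| ImpL: "G3ip (add_mset (Imp A B) \<Gamma>) A \<Longrightarrow> G3ip (add_mset B \<Gamma>) C
    \<Longrightarrow> G3ip (add_mset (Imp A B) \<Gamma>) C"
| ConjR: "G3ip \<Gamma> A \<Longrightarrow> G3ip \<Gamma> B \<Longrightarrow> G3ip \<Gamma> (Conj A B)"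
| DisjR1: "G3ip \<Gamma> A \<Longrightarrow> G3ip \<Gamma> (Disj A B)"
| DisjR2: "G3ip \<Gamma> B \<Longrightarrow> G3ip \<Gamma> (Disj A B)"
| ImpR: "G3ip (add_mset A \<Gamma>) B \<Longrightarrow> G3ip \<Gamma> (Imp A B)"

end

theory Submission imports Defs begin

text \<open>
  The two calculi treat the structural rules in opposite ways: \<open>G0Ti\<close> has weakening and
  contraction as rules and splits contexts between premisses, \<open>G3ip\<close> absorbs
  both into its initial sequents and its shared contexts.  Neither calculus has a cut rule, so
  each can be simulated by the other rule by rule, and cut elimination never enters.

  From \<open>G3ip\<close> to \<open>G0Ti\<close>, a two-premiss rule with a shared context \<open>\<Gamma>\<close>
  becomes the context-splitting rule followed by contractions of the duplicate copy of \<open>\<Gamma>\<close>.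

  From \<open>G0Ti\<close> to \<open>G3ip\<close>, split contexts are first made equal by weakening, so it
  suffices that generalized axioms, weakening and contraction are admissible in
  \<open>G3ip\<close>.  Only contraction is hard.  Suppose \<open>F\<close> occurs twice and one copy is principal in the
  last inference.  Inverting the rule for \<open>F\<close> on the other copy, still present in
  the premisses, replaces that copy by the same immediate subformulae that the
  inference introduced, and these duplicates are contracted instead.
  The one premiss in which this fails is the left premiss of the implication rule, where inversion
  is unavailable; but that premiss repeats the implication, so both copies survive there
  and the hypothesis for the shorter derivation applies.  Hence the induction is on the formula and,
  within it, on the derivation: the inverted derivation may be of any height, because it is
  only used with strictly smaller formulae.
\<close>

section \<open>Generalized structural rules of the context-splitting calculus\<close>

lemma G0Ti_weaken:
  assumes "G0Ti \<Gamma> C"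
  shows "G0Ti (\<Delta> + \<Gamma>) C"
  using assms by (induction \<Delta>) (auto intro: G0Ti.Weak)

lemma G0Ti_contract:
  assumes "G0Ti (\<Delta> + \<Delta> + \<Gamma>) C"
  shows "G0Ti (\<Delta> + \<Gamma>) C"
  using assms
proof (induction \<Delta> arbitrary: \<Gamma>)
  case empty
  then show ?case by simp
next
  case (add A \<Delta>)
  have "G0Ti (\<Delta> + \<Delta> + add_mset A (add_mset A \<Gamma>)) C"
    using add.prems by simp
  then have "G0Ti (\<Delta> + add_mset A (add_mset A \<Gamma>)) C"
    by (rule add.IH)
  from G0Ti.Contr[OF this[simplified]] show ?case
    by simp
qed

section \<open>Admissible rules of the context-sharing calculus\<close>

lemma G3ip_weaken:
  assumes "G3ip \<Gamma> C"
  shows "G3ip (\<Gamma> + \<Delta>) C"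
  using assms
proof induction
  case (ImpL A B \<Gamma> C)
  then show ?case by simp (rule G3ip.ImpL)
qed (simp_all add: G3ip.Ax G3ip.BotL G3ip.ConjL G3ip.DisjL G3ip.ConjR G3ip.DisjR1
    G3ip.DisjR2 G3ip.ImpR)

lemma G3ip_axiom: "G3ip (add_mset A \<Gamma>) A"
proof (induction A arbitrary: \<Gamma>)
  case (Conj A B)
  have "G3ip (add_mset A (add_mset B \<Gamma>)) B"
    using Conj.IH(2)[of "add_mset A \<Gamma>"] by (simp add: add_mset_commute)
  then show ?case
    using Conj.IH(1) by (intro G3ip.ConjL G3ip.ConjR)
next
  case (Imp A B)
  have "G3ip (add_mset (Imp A B) (add_mset A \<Gamma>)) B"
    using Imp.IH(1)[of "add_mset (Imp A B) \<Gamma>"] Imp.IH(2)[of "add_mset A \<Gamma>"]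
    by - (rule G3ip.ImpL, simp_all add: add_mset_commute)
  then show ?case
    by (intro G3ip.ImpR) (simp add: add_mset_commute)
qed (simp_all add: G3ip.Ax G3ip.BotL G3ip.DisjL G3ip.DisjR1 G3ip.DisjR2)

text \<open>
  The formulae by which an invertible premiss of a left rule replaces the principal formula.
  The left premiss of the implication rule contributes nothing, since its succedent differs
  from that of the conclusion.
\<close>

inductive reduct :: "'v form \<Rightarrow> 'v form multiset \<Rightarrow> bool" where
  "reduct (Conj A B) {#A, B#}"
| "reduct (Disj A B) {#A#}"
| "reduct (Disj A B) {#B#}"
| "reduct (Imp A B) {#B#}"

inductive_cases reduct_ConjE: "reduct (Conj A B) M"
inductive_cases reduct_DisjE: "reduct (Disj A B) M"
inductive_cases reduct_ImpE: "reduct (Imp A B) M"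
inductive_cases reduct_VarE: "reduct (Var p) M"
inductive_cases reduct_BotE: "reduct Bot M"

lemmas reduct_elims =
  reduct_ConjE reduct_DisjE reduct_ImpE reduct_VarE reduct_BotE

text \<open>
  Where \<open>F\<close> is principal, one of the premisses already is the sequent wanted.  Elsewhere \<open>F\<close> is
  a side formula passed on to every premiss, so the replacement commutes with the rule; initial
  sequents cause no trouble because neither a variable nor \<open>Bot\<close> has a reduct.
\<close>

lemma G3ip_invert:
  assumes "G3ip (add_mset F \<Gamma>) C" and "reduct F M"
  shows "G3ip (M + \<Gamma>) C"
  using assms(1)
proof (induction "add_mset F \<Gamma>" C arbitrary: \<Gamma>)
  case (Ax p \<Delta>)
  then show ?case
    using assms(2) by (auto simp: add_eq_conv_ex elim: reduct_elims intro: G3ip.Ax)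
next
  case (BotL \<Delta> C)
  then show ?case
    using assms(2) by (auto simp: add_eq_conv_ex elim: reduct_elims intro: G3ip.BotL)
next
  case (ConjL A B \<Delta> C)
  from ConjL.hyps(3) consider "F = Conj A B" "\<Gamma> = \<Delta>"
    | \<Psi> where "\<Delta> = add_mset F \<Psi>" "\<Gamma> = add_mset (Conj A B) \<Psi>"
    by (auto simp: add_eq_conv_ex)
  then show ?case
  proof cases
    case 1
    then show ?thesis
      using assms(2) ConjL.hyps(1) by (auto elim: reduct_elims)
  next
    case 2
    then show ?thesis
      using ConjL.hyps(2)[of "add_mset A (add_mset B \<Psi>)"]
      by (simp add: G3ip.ConjL add_mset_commute)
  qed
next
  case (DisjL A \<Delta> C B)
  from DisjL.hyps(5) consider "F = Disj A B" "\<Gamma> = \<Delta>"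
    | \<Psi> where "\<Delta> = add_mset F \<Psi>" "\<Gamma> = add_mset (Disj A B) \<Psi>"
    by (auto simp: add_eq_conv_ex)
  then show ?case
  proof cases
    case 1
    then show ?thesis
      using assms(2) DisjL.hyps(1,3) by (auto elim: reduct_elims)
  next
    case 2
    then show ?thesis
      using DisjL.hyps(2)[of "add_mset A \<Psi>"] DisjL.hyps(4)[of "add_mset B \<Psi>"]
      by (simp add: G3ip.DisjL add_mset_commute)
  qed
next
  case (ImpL A B \<Delta> C)
  from ImpL.hyps(5) consider "F = Imp A B" "\<Gamma> = \<Delta>"
    | \<Psi> where "\<Delta> = add_mset F \<Psi>" "\<Gamma> = add_mset (Imp A B) \<Psi>"
    by (auto simp: add_eq_conv_ex)
  then show ?case
  proof cases
    case 1
    then show ?thesis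
      using assms(2) ImpL.hyps(3) by (auto elim: reduct_elims)
  next
    case 2
    then show ?thesis
      using ImpL.hyps(2)[of "add_mset (Imp A B) \<Psi>"] ImpL.hyps(4)[of "add_mset B \<Psi>"]
      by (simp add: add_mset_commute) (rule G3ip.ImpL)
  qed
next
  case (ImpR A B)
  then show ?case
    using ImpR.hyps(2)[of "add_mset A \<Gamma>"] by (simp add: G3ip.ImpR add_mset_commute)
qed (simp_all add: G3ip.ConjR G3ip.DisjR1 G3ip.DisjR2)

text \<open>
  Inversion may change the derivation arbitrarily, so after it only the outer hypothesis, on
  the size of \<open>F\<close>, applies.  The inner hypothesis, on the derivation, serves the premisses in
  which both copies of \<open>F\<close> are still present.
\<close>

lemma G3ip_contract:
  assumes "G3ip (add_mset F (add_mset F \<Gamma>)) C"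
  shows "G3ip (add_mset F \<Gamma>) C"
  using assms
proof (induction F arbitrary: \<Gamma> C rule: measure_induct_rule[of size])
  case (less F)
  note smaller = less.IH
  from less.prems show ?case
  proof (induction "add_mset F (add_mset F \<Gamma>)" C arbitrary: \<Gamma>)
    case (Ax p \<Delta>)
    then show ?case
      by (auto simp: add_eq_conv_ex add_mset_commute[of F "Var p"] intro: G3ip.Ax)
  next
    case (BotL \<Delta> C)
    then show ?case
      by (auto simp: add_eq_conv_ex add_mset_commute[of F Bot] intro: G3ip.BotL)
  next
    case (ConjL A B \<Delta> C)
    from ConjL.hyps(3) consider "F = Conj A B" "\<Delta> = add_mset F \<Gamma>"
      | \<Psi> where "\<Delta> = add_mset F (add_mset F \<Psi>)" "\<Gamma> = add_mset (Conj A B) \<Psi>"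
      by (auto simp: add_eq_conv_ex)
    then show ?case
    proof cases
      case 1
      have "G3ip (add_mset (Conj A B) (add_mset A (add_mset B \<Gamma>))) C"
        using ConjL.hyps(1) 1 by (simp add: add_mset_commute)
      from G3ip_invert[OF this reduct.intros(1)]
      have "G3ip (add_mset A (add_mset A (add_mset B (add_mset B \<Gamma>)))) C"
        by (simp add: add_mset_commute)
      from smaller[OF _ this] 1
      have "G3ip (add_mset B (add_mset B (add_mset A \<Gamma>))) C"
        by (simp add: add_mset_commute)
      from smaller[OF _ this] 1 show ?thesis
        by (simp add: G3ip.ConjL add_mset_commute)
    next
      case 2
      then show ?thesis
        using ConjL.hyps(2)[of "add_mset A (add_mset B \<Psi>)"]
          G3ip.ConjL[of A B "add_mset F \<Psi>" C]
        by (simp add: add_mset_commute)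
    qed
  next
    case (DisjL A \<Delta> C B)
    from DisjL.hyps(5) consider "F = Disj A B" "\<Delta> = add_mset F \<Gamma>"
      | \<Psi> where "\<Delta> = add_mset F (add_mset F \<Psi>)" "\<Gamma> = add_mset (Disj A B) \<Psi>"
      by (auto simp: add_eq_conv_ex)
    then show ?case
    proof cases
      case 1
      have l: "G3ip (add_mset (Disj A B) (add_mset A \<Gamma>)) C"
        and r: "G3ip (add_mset (Disj A B) (add_mset B \<Gamma>)) C"
        using DisjL.hyps(1,3) 1 by (simp_all add: add_mset_commute)
      have "G3ip (add_mset A (add_mset A \<Gamma>)) C" "G3ip (add_mset B (add_mset B \<Gamma>)) C"
        using G3ip_invert[OF l reduct.intros(2)] G3ip_invert[OF r reduct.intros(3)] by simp_all
      from this[THEN smaller[rotated]] 1 show ?thesis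
        by (simp add: G3ip.DisjL)
    next
      case 2
      then show ?thesis
        using DisjL.hyps(2)[of "add_mset A \<Psi>"] DisjL.hyps(4)[of "add_mset B \<Psi>"]
          G3ip.DisjL[of A "add_mset F \<Psi>" C B]
        by (simp add: add_mset_commute)
    qed
  next
    case (ImpL A B \<Delta> C)
    from ImpL.hyps(5) consider "F = Imp A B" "\<Delta> = add_mset F \<Gamma>"
      | \<Psi> where "\<Delta> = add_mset F (add_mset F \<Psi>)" "\<Gamma> = add_mset (Imp A B) \<Psi>"
      by (auto simp: add_eq_conv_ex)
    then show ?case
    proof cases
      case 1
      \<comment> \<open>The left premiss keeps both copies of the implication, so the inner hypothesis serves it.\<close>
      have left: "G3ip (add_mset (Imp A B) \<Gamma>) A"
        using ImpL.hyps(2)[of \<Gamma>] 1 by simp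
      have "G3ip (add_mset (Imp A B) (add_mset B \<Gamma>)) C"
        using ImpL.hyps(3) 1 by (simp add: add_mset_commute)
      from G3ip_invert[OF this reduct.intros(4)]
      have "G3ip (add_mset B (add_mset B \<Gamma>)) C"
        by simp
      from smaller[OF _ this] 1 have "G3ip (add_mset B \<Gamma>) C"
        by simp
      with left have "G3ip (add_mset (Imp A B) \<Gamma>) C"
        by (rule G3ip.ImpL)
      with 1 show ?thesis
        by simp
    next
      case 2
      then show ?thesis
        using ImpL.hyps(2)[of "add_mset (Imp A B) \<Psi>"] ImpL.hyps(4)[of "add_mset B \<Psi>"]
          G3ip.ImpL[of A B "add_mset F \<Psi>" C]
        by (simp add: add_mset_commute)
    qed
  next
    case (ImpR A B)
    then show ?case
      using ImpR.hyps(2)[of "add_mset A \<Gamma>"] by (simp add: G3ip.ImpR add_mset_commute)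
  qed (simp_all add: G3ip.ConjR G3ip.DisjR1 G3ip.DisjR2)
qed

section \<open>Simulations in both directions\<close>

lemma G3ip_imp_G0Ti:
  assumes "G3ip \<Gamma> C"
  shows "G0Ti \<Gamma> C"
  using assms
proof induction
  case (Ax p \<Gamma>)
  then show ?case
    using G0Ti_weaken[OF G0Ti.Ax, of \<Gamma> "Var p"] by simp
next
  case (BotL \<Gamma> C)
  then show ?case
    using G0Ti_weaken[OF G0Ti.BotL, of \<Gamma> C] by simp
next
  case (DisjL A \<Gamma> C B)
  from G0Ti.DisjL[OF DisjL.IH] show ?case
    using G0Ti_contract[of \<Gamma> "{#Disj A B#}" C] by simp
next
  case (ImpL A B \<Gamma> C)
  from G0Ti.ImpL[OF ImpL.IH]
  have "G0Ti (\<Gamma> + \<Gamma> + {#Imp A B, Imp A B#}) C"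
    by simp
  from G0Ti.Contr[OF G0Ti_contract[OF this, simplified]] show ?case .
next
  case (ConjR \<Gamma> A B)
  from G0Ti.ConjR[OF ConjR.IH] show ?case
    using G0Ti_contract[of \<Gamma> "{#}" "Conj A B"] by simp
qed (simp_all add: G0Ti.ConjL G0Ti.DisjR1 G0Ti.DisjR2 G0Ti.ImpR)

lemma G0Ti_imp_G3ip:
  assumes "G0Ti \<Gamma> C"
  shows "G3ip \<Gamma> C"
  using assms
proof induction
  case (Ax A)
  show ?case by (rule G3ip_axiom)
next
  case (Weak \<Gamma> C A)
  then show ?case
    using G3ip_weaken[of \<Gamma> C "{#A#}"] by simp
next
  case (Contr A \<Gamma> C)
  from Contr.IH show ?case by (rule G3ip_contract)
next
  case (DisjL A \<Gamma> C B \<Delta>)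
  then show ?case
    using G3ip_weaken[of "add_mset A \<Gamma>" C \<Delta>] G3ip_weaken[of "add_mset B \<Delta>" C \<Gamma>]
    by (intro G3ip.DisjL) (simp_all add: add.commute)
next
  case (ImpL \<Gamma> A B \<Delta> C)
  then show ?case
    using G3ip_weaken[of \<Gamma> A "add_mset (Imp A B) \<Delta>"] G3ip_weaken[of "add_mset B \<Delta>" C \<Gamma>]
    by - (rule G3ip.ImpL, simp_all add: add.commute)
next
  case (ConjR \<Gamma> A \<Delta> B)
  then show ?case
    using G3ip_weaken[of \<Gamma> A \<Delta>] G3ip_weaken[of \<Delta> B \<Gamma>]
    by (intro G3ip.ConjR) (simp_all add: add.commute)
qed (simp_all add: G3ip.BotL G3ip.ConjL G3ip.DisjR1 G3ip.DisjR2 G3ip.ImpR)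

theorem theorem6p2:
  fixes \<Gamma> :: "'v::countable form multiset" and C :: "'v form"
  shows "G0Ti \<Gamma> C \<longleftrightarrow> G3ip \<Gamma> C"
  using G0Ti_imp_G3ip G3ip_imp_G0Ti by blast

end
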